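(* Let $(W,\sigma)$ be a symplectic vector space, let $T:W\to W$ be a linear map, and let $\omega_{\sigma,T}:W\times W\to\mathbb{T}$ be the function $$\omega_{\sigma,T}(\xi,\eta)=\mathrm{e}^{\mathrm{i}\sigma(\xi,T\eta)},\qquad \xi,\eta\in W.$$ Then $\omega_{\sigma,T}$ is a 2-cocycle (Schur multiplier). Moreover, $\omega_{\sigma,T}$ is non-degenerate, that is, for $\xi\in W$, $$\big(\omega_{\sigma,T}(\xi,\eta)=\omega_{\sigma,T}(\eta,\xi)\ \text{ for all }\eta\in W\big)\ \Rightarrow\ \xi=0,$$ if and only if $T+T^{\sigma}$ is an isomorphism.
   Context: A symplectic vector space $(W,\sigma)$ is a finite-dimensional real vector space $W$ with a non-degenerate antisymmetric bilinear form $\sigma$. The symplectic adjoint $T^{\sigma}:W\to W$ of a linear map $T$ is defined by $\sigma(T^{\sigma}\xi,\eta)=\sigma(\xi,T\eta)$ for all $\xi,\eta\in W$. $\mathbb{T}$ is the unit circle in $\mathbb{C}$. A 2-cocycle (Schur multiplier) on $W$ is a function $\omega:W\times W\to\mathbb{T}$ with $\omega(\xi,\eta)\omega(\xi+\eta,\zeta)=\omega(\xi,\eta+\zeta)\omega(\eta,\zeta)$ and $\omega(\xi,0)=\omega(0,\xi)=1$ for all $\xi,\eta,\zeta\in W$. *)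

theory Defs
  imports "HOL-Analysis.Analysis"
begin

text \<open>
  The whole type \<open>'a\<close> plays the role of \<open>W\<close>. It is only required to be a
  real vector space admitting a finite basis, so the zero space is included.
\<close>

definition symplectic_form :: "('a::real_vector \<Rightarrow> 'a \<Rightarrow> real) \<Rightarrow> bool" where
  "symplectic_form \<sigma> \<longleftrightarrow>
     bilinear \<sigma> \<and>
     (\<forall>\<xi> \<eta>. \<sigma> \<xi> \<eta> = - \<sigma> \<eta> \<xi>) \<and>
     (\<forall>\<xi>. (\<forall>\<eta>. \<sigma> \<xi> \<eta> = 0) \<longrightarrow> \<xi> = 0)"

definition symplectic_space :: "('a::real_vector \<Rightarrow> 'a \<Rightarrow> real) \<Rightarrow> bool" where
  "symplectic_space \<sigma> \<longleftrightarrow>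
     (\<exists>B :: 'a set. finite_dimensional_vector_space ((*\<^sub>R) :: real \<Rightarrow> 'a \<Rightarrow> 'a) B) \<and>
     symplectic_form \<sigma>"

text \<open>
  On a symplectic space, a linear \<open>T\<close> has exactly one map satisfying the
  equation below, so the description is proper; otherwise its value is unspecified.
\<close>

definition symplectic_adjoint ::
    "('a::real_vector \<Rightarrow> 'a \<Rightarrow> real) \<Rightarrow> ('a \<Rightarrow> 'a) \<Rightarrow> 'a \<Rightarrow> 'a" where
  "symplectic_adjoint \<sigma> T = (THE S. \<forall>\<xi> \<eta>. \<sigma> (S \<xi>) \<eta> = \<sigma> \<xi> (T \<eta>))"

definition two_cocycle :: "('a::ab_group_add \<Rightarrow> 'a \<Rightarrow> complex) \<Rightarrow> bool" where
  "two_cocycle \<omega> \<longleftrightarrow>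
     (\<forall>\<xi> \<eta>. \<omega> \<xi> \<eta> \<in> sphere 0 1) \<and>
     (\<forall>\<xi> \<eta> \<zeta>. \<omega> \<xi> \<eta> * \<omega> (\<xi> + \<eta>) \<zeta> = \<omega> \<xi> (\<eta> + \<zeta>) * \<omega> \<eta> \<zeta>) \<and>
     (\<forall>\<xi>. \<omega> \<xi> 0 = 1 \<and> \<omega> 0 \<xi> = 1)"

definition nondegenerate_cocycle :: "('a::ab_group_add \<Rightarrow> 'a \<Rightarrow> complex) \<Rightarrow> bool" where
  "nondegenerate_cocycle \<omega> \<longleftrightarrow> (\<forall>\<xi>. (\<forall>\<eta>. \<omega> \<xi> \<eta> = \<omega> \<eta> \<xi>) \<longrightarrow> \<xi> = 0)"

definition symplectic_multiplier ::
    "('a::real_vector \<Rightarrow> 'a \<Rightarrow> real) \<Rightarrow> ('a \<Rightarrow> 'a) \<Rightarrow> 'a \<Rightarrow> 'a \<Rightarrow> complex" where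
  "symplectic_multiplier \<sigma> T \<xi> \<eta> = exp (\<i> * complex_of_real (\<sigma> \<xi> (T \<eta>)))"

definition linear_isomorphism :: "('a::real_vector \<Rightarrow> 'b::real_vector) \<Rightarrow> bool" where
  "linear_isomorphism f \<longleftrightarrow> linear f \<and> bij f"

end

theory Submission
  imports Defs
begin

text \<open>
  Two elements \<open>\<xi>\<close>, \<open>\<eta>\<close> satisfy \<open>\<omega> \<xi> \<eta> = \<omega> \<eta> \<xi>\<close> iff \<open>\<sigma> ((T + T\<^sup>\<sigma>) \<xi>) \<eta>\<close> is an integer
  multiple of \<open>2 * pi\<close>. If this holds for all \<open>\<eta>\<close>, scaling \<open>\<eta>\<close> forces \<open>\<sigma> ((T + T\<^sup>\<sigma>) \<xi>) \<eta> = 0\<close>, so the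
  radical of \<open>\<omega>\<close> is the kernel of \<open>T + T\<^sup>\<sigma>\<close>, and in finite dimension an injective endomorphism
  is an isomorphism.
\<close>

lemma linear_inj_imp_surj_scaleR:
  fixes f :: "'a::real_vector \<Rightarrow> 'a" and B :: "'a set"
  assumes "finite_dimensional_vector_space ((*\<^sub>R) :: real \<Rightarrow> 'a \<Rightarrow> 'a) B"
    and "linear f" and "inj f"
  shows "surj f"
  using finite_dimensional_vector_space.linear_inj_imp_surj[OF assms(1)] assms(2,3)
  by (simp add: linear_def)

lemma finite_basis_scaleR:
  fixes B :: "'a::real_vector set"
  assumes "finite_dimensional_vector_space ((*\<^sub>R) :: real \<Rightarrow> 'a \<Rightarrow> 'a) B"
  shows "finite B" and "independent B" and "span B = UNIV"
  using finite_dimensional_vector_space.finite_Basis[OF assms]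
    finite_dimensional_vector_space.independent_Basis[OF assms]
    finite_dimensional_vector_space.span_Basis[OF assms]
  unfolding dependent_raw_def span_raw_def by blast+

text \<open>Riesz-type representation without a dual space: the values of a functional on the basis
  \<open>B\<close> are stored as coordinates of a vector of the same space, so the problem becomes
  surjectivity of an endomorphism.\<close>

lemma linear_functional_representation:
  fixes \<beta> :: "'a::real_vector \<Rightarrow> 'a \<Rightarrow> real" and f :: "'a \<Rightarrow> real"
  assumes fin: "finite_dimensional_vector_space ((*\<^sub>R) :: real \<Rightarrow> 'a \<Rightarrow> 'a) B"
    and bil: "bilinear \<beta>"
    and nondeg: "\<And>x. (\<And>y. \<beta> x y = 0) \<Longrightarrow> x = 0"
    and f: "linear f"
  obtains x where "\<And>y. \<beta> x y = f y"
proof -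
  note B = finite_basis_scaleR[OF fin]
  have lin: "linear (\<beta> x)" for x
    using bil by (simp add: bilinear_def)
  have coeff: "u b = v b" if "(\<Sum>b\<in>B. u b *\<^sub>R b) = (\<Sum>b\<in>B. v b *\<^sub>R b)" "b \<in> B" for u v b
  proof -
    have "(\<Sum>b\<in>B. (u b - v b) *\<^sub>R b) = 0"
      using that(1) by (simp add: scaleR_left_diff_distrib sum_subtractf)
    then have "u b - v b = 0"
      using independentD[OF B(2,1) subset_refl, of "\<lambda>b. u b - v b"] that(2) by blast
    then show ?thesis by simp
  qed
  \<comment> \<open>\<open>\<Phi> x\<close> has the values \<beta> x b as its
    \<open>B\<close>-coordinates. If they all vanish, \<beta> x vanishes on the span of
    \<open>B\<close>, and nondegeneracy gives x = 0; so \<open>\<Phi>\<close> is injective, hence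
    surjective.\<close>
  define \<Phi> where "\<Phi> x = (\<Sum>b\<in>B. \<beta> x b *\<^sub>R b)" for x
  have \<Phi>: "linear \<Phi>"
    by (rule linearI)
      (simp_all add: \<Phi>_def bilinear_ladd[OF bil] bilinear_lmul[OF bil]
        scaleR_left_distrib sum.distrib scaleR_sum_right)
  have "inj \<Phi>"
  proof (unfold linear_injective_0[OF \<Phi>], intro allI impI)
    fix x assume "\<Phi> x = 0"
    then have "\<beta> x b = 0" if "b \<in> B" for b
      using coeff[of "\<beta> x" "\<lambda>_. 0"] that by (simp add: \<Phi>_def)
    then have "\<beta> x y = 0" for y
      using linear_eq_on[OF lin linear_zero, of y B x] B(3) by simp
    then show "x = 0" by (rule nondeg)
  qed
  then have "surj \<Phi>"
    by (rule linear_inj_imp_surj_scaleR[OF fin \<Phi>])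
  \<comment> \<open>A preimage of the vector with coordinates f b gives a functional \<beta> x that
    agrees with f on \<open>B\<close>, hence everywhere.\<close>
  then obtain x where "\<Phi> x = (\<Sum>b\<in>B. f b *\<^sub>R b)"
    by (metis surjD)
  then have "\<beta> x b = f b" if "b \<in> B" for b
    using coeff[of "\<beta> x" f] that by (simp add: \<Phi>_def)
  then have "\<beta> x y = f y" for y
    using linear_eq_on[OF lin f, of y B x] B(3) by simp
  then show thesis by (rule that)
qed

text \<open>The difference x - y lies in the radical of \<sigma>. This test yields uniqueness and
  linearity of the adjoint.\<close>

lemma symplectic_form_eqI:
  assumes "symplectic_form \<sigma>" and "\<And>z. \<sigma> x z = \<sigma> y z"
  shows "x = y"
proof -
  have "\<sigma> (x - y) z = 0" for z
    using assms(2) bilinear_lsub[of \<sigma>] assms(1) unfolding symplectic_form_def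
    by (metis cancel_comm_monoid_add_class.diff_cancel)
  then have "x - y = 0"
    using assms(1) unfolding symplectic_form_def by blast
  then show ?thesis by simp
qed

text \<open>The definite description is justified here: representing the functional \<sigma> \<xi>
  (T y) of y, for each \<xi>, gives existence, and nondegeneracy gives uniqueness.\<close>

lemma symplectic_adjoint:
  fixes \<sigma> :: "'a::real_vector \<Rightarrow> 'a \<Rightarrow> real"
  assumes "symplectic_space \<sigma>" and "linear T"
  shows "\<sigma> (symplectic_adjoint \<sigma> T \<xi>) \<eta> = \<sigma> \<xi> (T \<eta>)"
proof -
  obtain B :: "'a set" where
    fin: "finite_dimensional_vector_space ((*\<^sub>R) :: real \<Rightarrow> 'a \<Rightarrow> 'a) B"
    and symp: "symplectic_form \<sigma>"
    using assms(1) by (auto simp: symplectic_space_def)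
  have bil: "bilinear \<sigma>"
    and nondeg: "\<And>x. (\<And>y. \<sigma> x y = 0) \<Longrightarrow> x = 0"
    using symp unfolding symplectic_form_def by blast+
  have "\<exists>x. \<forall>y. \<sigma> x y = \<sigma> \<xi> (T y)" for \<xi>
  proof -
    have "linear (\<lambda>y. \<sigma> \<xi> (T y))"
      using linear_compose[OF assms(2), of "\<sigma> \<xi>"] bil by (simp add: bilinear_def o_def)
    then show ?thesis
      using linear_functional_representation[OF fin bil nondeg] by metis
  qed
  then obtain S where S: "\<forall>\<xi> \<eta>. \<sigma> (S \<xi>) \<eta> = \<sigma> \<xi> (T \<eta>)"
    by metis
  moreover have "S' = S" if "\<forall>\<xi> \<eta>. \<sigma> (S' \<xi>) \<eta> = \<sigma> \<xi> (T \<eta>)" for S'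
    using that S by (intro ext symplectic_form_eqI[OF symp]) simp
  ultimately have "\<forall>\<xi> \<eta>. \<sigma> (symplectic_adjoint \<sigma> T \<xi>) \<eta> = \<sigma> \<xi> (T \<eta>)"
    unfolding symplectic_adjoint_def by (rule theI)
  then show ?thesis by blast
qed

text \<open>Paired with any vector, the adjoint turns into \<sigma> \<xi> (T \<eta>), which is
  visibly linear in \<xi>.\<close>

lemma linear_symplectic_adjoint:
  assumes "symplectic_space \<sigma>" and "linear T"
  shows "linear (symplectic_adjoint \<sigma> T)"
proof -
  have symp: "symplectic_form \<sigma>" and bil: "bilinear \<sigma>"
    using assms(1) unfolding symplectic_space_def symplectic_form_def by blast+
  show ?thesis
    by (rule linearI; rule symplectic_form_eqI[OF symp])
      (simp_all add: symplectic_adjoint[OF assms] bilinear_ladd[OF bil] bilinear_lmul[OF bil])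
qed

text \<open>Both sides of the cocycle identity have exponent i (\<beta> x y + \<beta> x z + \<beta>
  y z); the modulus is 1 because \<beta> is real.\<close>

lemma two_cocycle_exp_bilinear:
  assumes "bilinear \<beta>"
  shows "two_cocycle (\<lambda>x y. exp (\<i> * complex_of_real (\<beta> x y)))"
  by (simp add: two_cocycle_def bilinear_ladd[OF assms] bilinear_radd[OF assms]
      bilinear_lzero[OF assms] bilinear_rzero[OF assms] exp_add distrib_left)

lemma exp_ii_all_multiples_eq_1:
  fixes r :: real
  assumes "\<And>t. exp (\<i> * complex_of_real (t * r)) = 1"
  shows "r = 0"
proof (rule ccontr)
  assume "r \<noteq> 0"
  \<comment> \<open>The multiple t = pi / r turns the exponent into i pi, where the exponential is
    -1.\<close>
  then have "exp (\<i> * complex_of_real pi) = 1"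
    using assms[of "pi / r"] by simp
  then show False by simp
qed

lemma symplectic_multiplier_commute_iff:
  assumes "symplectic_space \<sigma>" and "linear T"
  shows "(\<forall>\<eta>. symplectic_multiplier \<sigma> T \<xi> \<eta> = symplectic_multiplier \<sigma> T \<eta> \<xi>) \<longleftrightarrow>
    T \<xi> + symplectic_adjoint \<sigma> T \<xi> = 0"
proof -
  define x where "x = T \<xi> + symplectic_adjoint \<sigma> T \<xi>"
  have symp: "symplectic_form \<sigma>" and bil: "bilinear \<sigma>"
    and anti: "\<And>\<xi> \<eta>. \<sigma> \<xi> \<eta> = - \<sigma> \<eta> \<xi>"
    using assms(1) unfolding symplectic_space_def symplectic_form_def by blast+
  \<comment> \<open>The adjoint turns \<sigma> \<xi> (T \<eta>) into a pairing with \<eta> on the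
    right, and antisymmetry does the same to \<sigma> \<eta> (T \<xi>) with a minus sign; hence the
    sum, not the difference, of T and its adjoint in x.\<close>
  have "\<sigma> \<xi> (T \<eta>) = \<sigma> \<eta> (T \<xi>) + \<sigma> x \<eta>" for \<eta>
    using anti[of \<eta> "T \<xi>"] by (simp add: x_def bilinear_ladd[OF bil] symplectic_adjoint[OF assms])
  \<comment> \<open>The two multiplier values differ by the factor exp (i \<sigma> x \<eta>), and
    the common exponential is nonzero.\<close>
  then have commute: "symplectic_multiplier \<sigma> T \<xi> \<eta> = symplectic_multiplier \<sigma> T \<eta> \<xi> \<longleftrightarrow>
      exp (\<i> * complex_of_real (\<sigma> x \<eta>)) = 1" for \<eta>
    by (simp add: symplectic_multiplier_def exp_add distrib_left)
  have "x = 0" if "\<forall>\<eta>. exp (\<i> * complex_of_real (\<sigma> x \<eta>)) = 1"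
  proof (rule symplectic_form_eqI[OF symp])
    fix \<eta>
    have "exp (\<i> * complex_of_real (t * \<sigma> x \<eta>)) = 1" for t
      using that[rule_format, of "t *\<^sub>R \<eta>"] by (simp add: bilinear_rmul[OF bil])
    then have "\<sigma> x \<eta> = 0" by (rule exp_ii_all_multiples_eq_1)
    then show "\<sigma> x \<eta> = \<sigma> 0 \<eta>" by (simp add: bilinear_lzero[OF bil])
  qed
  then show ?thesis
    unfolding commute x_def[symmetric] by (auto simp: bilinear_lzero[OF bil])
qed

theorem lemma3p1:
  fixes \<sigma> :: "'a::real_vector \<Rightarrow> 'a \<Rightarrow> real" and T :: "'a \<Rightarrow> 'a"
  assumes "symplectic_space \<sigma>" and "linear T"
  shows "two_cocycle (symplectic_multiplier \<sigma> T) \<and>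
    (nondegenerate_cocycle (symplectic_multiplier \<sigma> T) \<longleftrightarrow>
      linear_isomorphism (\<lambda>\<xi>. T \<xi> + symplectic_adjoint \<sigma> T \<xi>))"
proof
  obtain B :: "'a set" where
    fin: "finite_dimensional_vector_space ((*\<^sub>R) :: real \<Rightarrow> 'a \<Rightarrow> 'a) B"
    and bil: "bilinear \<sigma>"
    using assms(1) unfolding symplectic_space_def symplectic_form_def by blast
  have "bilinear (\<lambda>\<xi> \<eta>. \<sigma> \<xi> (T \<eta>))"
    using bil linear_add[OF assms(2)] linear_scale[OF assms(2)]
    by (simp add: bilinear_def linear_iff)
  then show "two_cocycle (symplectic_multiplier \<sigma> T)"
    using two_cocycle_exp_bilinear by (simp add: symplectic_multiplier_def[abs_def])
  define S where "S = (\<lambda>\<xi>. T \<xi> + symplectic_adjoint \<sigma> T \<xi>)"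
  have S: "linear S"
    unfolding S_def by (intro linear_compose_add assms linear_symplectic_adjoint)
  have "nondegenerate_cocycle (symplectic_multiplier \<sigma> T) \<longleftrightarrow> inj S"
    unfolding nondegenerate_cocycle_def symplectic_multiplier_commute_iff[OF assms]
      linear_injective_0[OF S] by (simp add: S_def)
  also have "\<dots> \<longleftrightarrow> linear_isomorphism S"
    using S linear_inj_imp_surj_scaleR[OF fin S] by (auto simp: linear_isomorphism_def bij_def)
  finally show "nondegenerate_cocycle (symplectic_multiplier \<sigma> T) \<longleftrightarrow>
      linear_isomorphism (\<lambda>\<xi>. T \<xi> + symplectic_adjoint \<sigma> T \<xi>)"
    unfolding S_def .
qed

end
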